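(* Let $E$ be a finite set (the edge set of a finite directed graph), let $\lambda=(s_1,\dots,s_q)$ be a multiset of positive integers with $s_1+\cdots+s_q=|E|$, and let $m_1$ and $m_2$ be the numbers of indices $i$ with $s_i=1$ and $s_i=2$, respectively. Then every vertex of the transposition graph $\mathcal S_\lambda(E)$ has degree $$\sum_{1\le i<j\le q}s_is_j-\binom{m_1}{2}-2\binom{m_2}{2}.$$
   Context: An edge partition is an unlabelled collection of nonempty pairwise disjoint subsets (blocks) of $E$ whose union is $E$; its profile is the multiset of its block sizes. $\mathcal P_\lambda(E)$ is the set of edge partitions with profile $\lambda$. The transposition graph $\mathcal S_\lambda(E)$ is the simple undirected graph with vertex set $\mathcal P_\lambda(E)$ in which distinct partitions $\Pi\neq\Pi'$ are adjacent when $\Pi'$ is obtained from $\Pi$ by choosing distinct blocks $A,B\in\Pi$, an edge $e\in A$ and an edge $f\in B$, and replacing $A,B$ by $(A\setminus\{e\})\cup\{f\}$ and $(B\setminus\{f\})\cup\{e\}$. Moves that reproduce the same unlabelled partition are discarded. *)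

theory Defs
  imports "HOL-Library.Multiset" "HOL-Library.Disjoint_Sets"
begin

text \<open>Simple undirected graphs: edges are unordered pairs, represented as two-element sets
  of vertices.\<close>

record 'v ugraph =
  vertices :: "'v set"
  edges :: "'v set set"

definition simple_graph :: "'v ugraph \<Rightarrow> bool" where
  "simple_graph G \<longleftrightarrow> (\<forall>x\<in>edges G. x \<subseteq> vertices G \<and> card x = 2)"

definition degree :: "'v ugraph \<Rightarrow> 'v \<Rightarrow> nat" where
  "degree G v = card {x \<in> edges G. v \<in> x}"

definition profile :: "'e set set \<Rightarrow> nat multiset" where
  "profile P = image_mset card (mset_set P)"

definition edge_partitions :: "nat multiset \<Rightarrow> 'e set \<Rightarrow> 'e set set set" where
  "edge_partitions lam E = {P. partition_on E P \<and> profile P = lam}"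

text \<open>A move may reproduce the partition it starts from (for instance when both blocks are
  singletons); such moves are discarded in the graph below.\<close>

definition transposition_move :: "'e set set \<Rightarrow> 'e set set \<Rightarrow> bool" where
  "transposition_move P Q \<longleftrightarrow>
    (\<exists>A\<in>P. \<exists>B\<in>P. A \<noteq> B \<and>
      (\<exists>e\<in>A. \<exists>f\<in>B. Q = (P - {A, B}) \<union> {(A - {e}) \<union> {f}, (B - {f}) \<union> {e}}))"

definition transposition_graph :: "nat multiset \<Rightarrow> 'e set \<Rightarrow> 'e set set ugraph" where
  "transposition_graph lam E =
    \<lparr>vertices = edge_partitions lam E,
     edges = {{P, Q} | P Q. P \<in> edge_partitions lam E \<and> Q \<in> edge_partitions lam E \<and>
                            P \<noteq> Q \<and> transposition_move P Q}\<rparr>"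

lemma simple_graph_transposition_graph: "simple_graph (transposition_graph lam E)"
  by (auto simp: simple_graph_def transposition_graph_def card_2_iff)

end

(* The neighbours of P are sorted by the unordered pair {A, B} of blocks that the move changes.
   A partition Q \<noteq> P obtained from A, B determines this pair as P - Q, so the
   neighbourhood is a disjoint union over pairs of blocks. For one pair, the swap of e \<in> A with
   f \<in> B yields card A * card B distinct partitions, with two exceptions: for two
   singletons the only swap gives P back, and for two blocks of size 2 complementary swaps
   coincide, leaving 2 partitions instead of 4. *)

theory Submission
  imports Defs
begin

section \<open>Swaps and their nontrivial results\<close>

definition swap_elements :: "'e set set \<Rightarrow> 'e set \<Rightarrow> 'e set \<Rightarrow> 'e \<Rightarrow> 'e \<Rightarrow> 'e set set" where
  "swap_elements P A B e f = (P - {A, B}) \<union> {(A - {e}) \<union> {f}, (B - {f}) \<union> {e}}"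

text \<open>Collecting results in a set, rather than indexing them by \<open>(e, f)\<close>, makes
  swaps with the same outcome count once.\<close>

definition swap_neighbours :: "'e set set \<Rightarrow> 'e set \<Rightarrow> 'e set \<Rightarrow> 'e set set set" where
  "swap_neighbours P A B = (\<lambda>(e, f). swap_elements P A B e f) ` (A \<times> B) - {P}"

lemma transposition_move_iff:
  "transposition_move P Q \<longleftrightarrow>
    (\<exists>A\<in>P. \<exists>B\<in>P. A \<noteq> B \<and> (\<exists>e\<in>A. \<exists>f\<in>B. Q = swap_elements P A B e f))"
  unfolding transposition_move_def swap_elements_def ..

lemma nontrivial_transposition_move_iff:
  "Q \<noteq> P \<and> transposition_move P Q \<longleftrightarrow>
    (\<exists>A\<in>P. \<exists>B\<in>P. A \<noteq> B \<and> Q \<in> swap_neighbours P A B)"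
proof -
  have "Q \<in> swap_neighbours P A B \<longleftrightarrow> Q \<noteq> P \<and> (\<exists>e\<in>A. \<exists>f\<in>B. Q = swap_elements P A B e f)" for A B
    by (auto simp: swap_neighbours_def)
  then show ?thesis
    unfolding transposition_move_iff by metis
qed

lemma swap_elements_commute: "swap_elements P B A f e = swap_elements P A B e f"
  by (auto simp: swap_elements_def)

text \<open>Makes the neighbours depend only on the unordered pair of blocks, so that indices
  \<open>i < j\<close> suffice later.\<close>

lemma swap_neighbours_commute: "swap_neighbours P B A = swap_neighbours P A B"
  unfolding swap_neighbours_def using swap_elements_commute by fast

section \<open>Effect of a single swap on a partition\<close>

locale swap_in_partition =
  fixes E :: "'e set" and P A B e f
  assumes part: "partition_on E P"
    and A: "A \<in> P" and B: "B \<in> P" and AB: "A \<noteq> B" and e: "e \<in> A" and f: "f \<in> B"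
begin

abbreviation "A' \<equiv> (A - {e}) \<union> {f}"
abbreviation "B' \<equiv> (B - {f}) \<union> {e}"
abbreviation "Q \<equiv> swap_elements P A B e f"

lemma disjoint_blocks: "A \<inter> B = {}"
  using partition_onD2[OF part] A B AB by (auto simp: disjoint_def)

lemma other_block: "C \<in> P \<Longrightarrow> C \<noteq> A \<Longrightarrow> C \<noteq> B \<Longrightarrow> C \<inter> (A \<union> B) = {}"
  using partition_onD2[OF part] A B by (auto simp: disjoint_def)

lemma e_notin: "e \<notin> B" and f_notin: "f \<notin> A" and e_neq_f: "e \<noteq> f"
  using disjoint_blocks e f by auto

lemma new_blocks_neq: "A' \<noteq> B'"
  using f_notin e_neq_f by auto

text \<open>\<open>A'\<close> contains \<open>f\<close> and \<open>B'\<close> contains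
  \<open>e\<close>, while the untouched blocks are disjoint from
  \<open>A \<union> B\<close>.\<close>

lemma new_blocks_notin: "A' \<notin> P - {A, B}" "B' \<notin> P - {A, B}"
  using other_block e f by blast+

text \<open>If nothing changes, \<open>A'\<close> must be \<open>B\<close> and \<open>B'\<close>
  must be \<open>A\<close>. Then \<open>A - {e}\<close> lies in \<open>B\<close> and
  \<open>B - {f}\<close> lies in \<open>A\<close>, so disjointness makes both empty.\<close>

lemma swap_eq_self_iff: "Q = P \<longleftrightarrow> A = {e} \<and> B = {f}"
proof
  assume "Q = P"
  then have "A' \<in> P" "B' \<in> P"
    by (auto simp: swap_elements_def)
  then have "A' = B" "B' = A"
    using new_blocks_notin e_notin f_notin by blast+
  then show "A = {e} \<and> B = {f}"
    using disjoint_blocks e f by blast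
next
  assume "A = {e} \<and> B = {f}"
  then show "Q = P"
    using A B unfolding swap_elements_def by auto
qed

lemma new_blocks_notin_old:
  assumes "Q \<noteq> P"
  shows "A' \<notin> P" "B' \<notin> P"
proof -
  \<comment> \<open>Either equality would force both blocks to be singletons, which is the trivial
    swap.\<close>
  have "A' \<noteq> B" "B' \<noteq> A"
    using assms disjoint_blocks e f unfolding swap_eq_self_iff by blast+
  then show "A' \<notin> P" "B' \<notin> P"
    using new_blocks_notin e_notin f_notin by blast+
qed

text \<open>A nontrivial swap removes both old blocks and adds two that are new to \<open>P\<close>.
  The first difference separates the neighbours belonging to different pairs of blocks; the second
  serves to compare swaps within one pair.\<close>

lemma old_minus_new: "Q \<noteq> P \<Longrightarrow> P - Q = {A, B}"
  and new_minus_old: "Q \<noteq> P \<Longrightarrow> Q - P = {A', B'}"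
  using new_blocks_notin_old A B by (auto simp: swap_elements_def)

lemma partition_on_swap: "partition_on E Q"
proof (rule partition_onI)
  have "\<Union>Q = \<Union>(P - {A, B}) \<union> (A \<union> B)"
    using e f by (auto simp: swap_elements_def)
  also have "\<dots> = \<Union>P"
    using A B by blast
  finally show "\<Union>Q = E"
    using partition_onD1[OF part] by simp
next
  show "{} \<notin> Q"
    using partition_onD3[OF part] by (auto simp: swap_elements_def)
next
  \<comment> \<open>The new blocks stay inside \<open>A \<union> B\<close>, which every untouched
    block avoids; this settles the mixed cases.\<close>
  have sub: "A' \<subseteq> A \<union> B" "B' \<subseteq> A \<union> B" and new: "A' \<inter> B' = {}"
    using e f disjoint_blocks by blast+
  fix C D assume "C \<in> Q" "D \<in> Q" "C \<noteq> D"
  then consider "C \<in> P - {A, B}" "D \<in> P - {A, B}" | "C \<in> P - {A, B}" "D \<in> {A', B'}"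
    | "C \<in> {A', B'}" "D \<in> P - {A, B}" | "C \<in> {A', B'}" "D \<in> {A', B'}"
    unfolding swap_elements_def by (meson UnE)
  then have "C \<inter> D = {}"
  proof cases
    case 1
    then show ?thesis
      using \<open>C \<noteq> D\<close> partition_onD2[OF part] by (auto simp: disjoint_def)
  next
    case 2
    then have "D \<subseteq> A \<union> B" "C \<inter> (A \<union> B) = {}"
      using sub other_block[of C] by (metis empty_iff insert_iff, simp)
    then show ?thesis
      by blast
  next
    case 3
    then have "C \<subseteq> A \<union> B" "D \<inter> (A \<union> B) = {}"
      using sub other_block[of D] by (metis empty_iff insert_iff, simp)
    then show ?thesis
      by blast
  next
    case 4
    then show ?thesis
      using new \<open>C \<noteq> D\<close> by (metis Int_commute empty_iff insert_iff)
  qed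
  then show "disjnt C D"
    by (simp add: disjnt_def)
qed

text \<open>Each changed block loses one element and gains one from outside, so its size persists.
  Since \<open>A'\<close> and \<open>B'\<close> are distinct and not among the untouched blocks,
  \<open>mset_set\<close> merges none of them.\<close>

lemma profile_swap:
  assumes "finite E"
  shows "profile Q = profile P"
proof -
  let ?R = "P - {A, B}"
  have fin: "finite ?R" "finite A" "finite B"
    using finite_elements[OF assms part] partition_onD1[OF part] A B
    by (auto intro: finite_subset[OF _ assms])
  have "card A' = card A" "card B' = card B"
    using card_Suc_Diff1[of A e] card_Suc_Diff1[of B f] fin e f e_notin f_notin by simp_all
  moreover have "P = insert A (insert B ?R)" "Q = insert A' (insert B' ?R)"
    using A B by (auto simp: swap_elements_def)
  then have "mset_set P = add_mset A (add_mset B (mset_set ?R))"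
    "mset_set Q = add_mset A' (add_mset B' (mset_set ?R))"
    using fin AB new_blocks_neq new_blocks_notin
    by (metis (no_types, lifting) DiffE finite_insert insertCI insertE mset_set.insert)+
  ultimately show ?thesis
    by (simp add: profile_def)
qed

lemma swap_back: "P = swap_elements Q A' B' f e"
proof -
  have "Q - {A', B'} = P - {A, B}"
    using new_blocks_notin by (auto simp: swap_elements_def)
  moreover have "A' - {f} \<union> {e} = A" "B' - {e} \<union> {f} = B"
    using e f e_notin f_notin by auto
  ultimately show ?thesis
    using A B unfolding swap_elements_def[of Q] by auto
qed

lemma transposition_move_back: "transposition_move Q P"
  unfolding transposition_move_iff
proof (intro bexI conjI)
  show "P = swap_elements Q A' B' f e" by (rule swap_back)
qed (use new_blocks_neq in \<open>auto simp: swap_elements_def\<close>)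

end

section \<open>Number of distinct results for one pair of blocks\<close>

lemma swap_elements_inj:
  assumes "partition_on E P" "A \<in> P" "B \<in> P" "A \<noteq> B"
    and "e \<in> A" "f \<in> B" "e' \<in> A" "f' \<in> B"
    and eq: "swap_elements P A B e f = swap_elements P A B e' f'"
    and neq: "swap_elements P A B e f \<noteq> P"
    and two: "\<not> (card A = 2 \<and> card B = 2)"
  shows "e = e' \<and> f = f'"
proof -
  interpret s1: swap_in_partition E P A B e f
    using assms by unfold_locales
  interpret s2: swap_in_partition E P A B e' f'
    using assms by unfold_locales
  \<comment> \<open>Equal results have the same two blocks outside \<open>P\<close>, matched either
    straight or crosswise.\<close>
  have "{s1.A', s1.B'} = {s2.A', s2.B'}"
    using s1.new_minus_old s2.new_minus_old eq neq by metis
  then consider "s1.A' = s2.A'" | "s1.A' = s2.B'" "s1.B' = s2.A'"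
    by (metis doubleton_eq_iff)
  then show ?thesis
  proof cases
    case 1
    then show ?thesis
      using s1.disjoint_blocks assms(5-8) by blast
  next
    case 2
    \<comment> \<open>Intersecting the crosswise equalities with \<open>A\<close> and with
      \<open>B\<close> gives \<open>A - {e} = {e'}\<close> and \<open>B - {f} = {f'}\<close>, so
      both blocks have size 2.\<close>
    have "x = e \<or> x = e'" if "x \<in> A" for x
      using that 2(1) s1.disjoint_blocks assms(5-8) by blast
    moreover have "x = f \<or> x = f'" if "x \<in> B" for x
      using that 2(2) s1.disjoint_blocks assms(5-8) by blast
    ultimately have "A = {e, e'}" "B = {f, f'}"
      using assms(5-8) by auto
    moreover have "e \<noteq> e'" "f \<noteq> f'"
      using 2(1) s1.disjoint_blocks assms(5-8) by auto
    ultimately show ?thesis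
      using two by simp
  qed
qed

text \<open>The corrections are added on the left to avoid truncated subtraction of naturals.
  Outside the two exceptional cases every swap is nontrivial and swapping is injective on
  \<open>A \<times> B\<close>.\<close>

lemma card_swap_neighbours:
  assumes part: "partition_on E P" and A: "A \<in> P" and B: "B \<in> P" and "A \<noteq> B"
  shows "card (swap_neighbours P A B) + of_bool (card A = 1 \<and> card B = 1)
    + 2 * of_bool (card A = 2 \<and> card B = 2) = card A * card B"
proof -
  have swap: "swap_in_partition E P A B e f" if "e \<in> A" "f \<in> B" for e f
    using that assms by unfold_locales
  consider (one) "card A = 1" "card B = 1" | (two) "card A = 2" "card B = 2"
    | (other) "\<not> (card A = 1 \<and> card B = 1)" "\<not> (card A = 2 \<and> card B = 2)"
    by blast
  then show ?thesis
  proof cases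
    case one
    then obtain e f where ef: "A = {e}" "B = {f}"
      by (auto simp: card_1_singleton_iff)
    then have "swap_elements P A B e f = P"
      using swap_in_partition.swap_eq_self_iff[OF swap] by simp
    with ef show ?thesis
      by (simp add: swap_neighbours_def)
  next
    case two
    then obtain a b c d where ab: "A = {a, b}" "a \<noteq> b" and cd: "B = {c, d}" "c \<noteq> d"
      by (metis card_2_iff)
    have disj: "A \<inter> B = {}"
      using partition_onD2[OF part] A B \<open>A \<noteq> B\<close> by (auto simp: disjoint_def)
    have new: "a \<noteq> c" "a \<noteq> d" "b \<noteq> c" "b \<noteq> d"
      using disj ab cd by auto
    let ?Q1 = "swap_elements P A B a c" and ?Q2 = "swap_elements P A B a d"
    \<comment> \<open>Swapping the complementary elements yields the same two blocks in exchanged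
      roles.\<close>
    have coincide: "swap_elements P A B b d = ?Q1" "swap_elements P A B b c = ?Q2"
      using new ab cd unfolding swap_elements_def by (simp_all add: insert_Diff_if insert_commute)
    have nontriv: "?Q1 \<noteq> P" "?Q2 \<noteq> P"
      using swap_in_partition.swap_eq_self_iff[OF swap] ab cd by auto
    \<comment> \<open>The element \<open>a\<close> ends up together with \<open>d\<close> on the
      left and with \<open>c\<close> on the right.\<close>
    have "{(A - {a}) \<union> {c}, (B - {c}) \<union> {a}} \<noteq> {(A - {a}) \<union> {d}, (B - {d}) \<union> {a}}"
      using new ab cd by (auto simp: doubleton_eq_iff)
    then have "?Q1 \<noteq> ?Q2"
      using swap_in_partition.new_minus_old[OF swap] nontriv ab cd by (metis insertCI)
    moreover have "swap_neighbours P A B = {?Q1, ?Q2}"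
    proof -
      have "A \<times> B = {(a, c), (a, d), (b, c), (b, d)}"
        using ab cd by auto
      then show ?thesis
        using coincide nontriv by (auto simp: swap_neighbours_def)
    qed
    ultimately show ?thesis
      using two by simp
  next
    case other
    have nontriv: "swap_elements P A B e f \<noteq> P" if "e \<in> A" "f \<in> B" for e f
      using swap_in_partition.swap_eq_self_iff[OF swap[OF that]] other by auto
    then have "swap_neighbours P A B = (\<lambda>(e, f). swap_elements P A B e f) ` (A \<times> B)"
      by (auto simp: swap_neighbours_def)
    moreover have "inj_on (\<lambda>(e, f). swap_elements P A B e f) (A \<times> B)"
      using swap_elements_inj[OF part A B \<open>A \<noteq> B\<close>] nontriv other(2)
      by (auto simp: inj_on_def)
    ultimately show ?thesis
      using other by (simp add: card_image card_cartesian_product)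
  qed
qed

lemma swap_neighbours_diff:
  assumes "partition_on E P" "A \<in> P" "B \<in> P" "A \<noteq> B" "Q \<in> swap_neighbours P A B"
  shows "P - Q = {A, B}"
proof -
  obtain e f where ef: "e \<in> A" "f \<in> B" and Q: "Q = swap_elements P A B e f" and "Q \<noteq> P"
    using assms(5) by (auto simp: swap_neighbours_def)
  interpret swap_in_partition E P A B e f
    using assms ef by unfold_locales
  show ?thesis
    using old_minus_new \<open>Q \<noteq> P\<close> Q by simp
qed

section \<open>The degree as a number of nontrivial moves\<close>

lemma transposition_move_sym:
  assumes "partition_on E P" "transposition_move P Q"
  shows "transposition_move Q P"
  using assms swap_in_partition.transposition_move_back
  unfolding transposition_move_iff[of P] swap_in_partition_def by metis

lemma transposition_move_edge_partitions:
  assumes "finite E" "P \<in> edge_partitions lam E" "transposition_move P Q"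
  shows "Q \<in> edge_partitions lam E"
  using assms swap_in_partition.partition_on_swap swap_in_partition.profile_swap
  unfolding transposition_move_iff[of P] swap_in_partition_def edge_partitions_def mem_Collect_eq
  by metis

lemma degree_transposition_graph:
  assumes "finite E" and P: "P \<in> edge_partitions lam E"
  shows "degree (transposition_graph lam E) P = card {Q. Q \<noteq> P \<and> transposition_move P Q}"
proof -
  have "{x \<in> edges (transposition_graph lam E). P \<in> x}
      = (\<lambda>Q. {P, Q}) ` {Q. Q \<noteq> P \<and> transposition_move P Q}" (is "?L = ?R")
  proof (intro equalityI subsetI)
    fix x assume "x \<in> ?L"
    then obtain R Q where x: "x = {R, Q}" "P \<in> x" "R \<in> edge_partitions lam E"
      "R \<noteq> Q" "transposition_move R Q"
      by (auto simp: transposition_graph_def)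
    \<comment> \<open>Edges are unordered, so \<open>P\<close> may be the target \<open>Q\<close> of
      the recorded move; the reverse move then starts at \<open>P\<close>.\<close>
    then have "transposition_move Q R"
      using transposition_move_sym unfolding edge_partitions_def by blast
    with x show "x \<in> ?R"
      by (auto simp: insert_commute)
  next
    fix x assume "x \<in> ?R"
    then show "x \<in> ?L"
      using P transposition_move_edge_partitions[OF assms]
      by (auto simp: transposition_graph_def)
  qed
  moreover have "inj_on (\<lambda>Q. {P, Q}) {Q. Q \<noteq> P \<and> transposition_move P Q}"
    by (auto simp: inj_on_def doubleton_eq_iff)
  ultimately show ?thesis
    by (simp add: degree_def card_image)
qed

section \<open>Lifting enumerations, and binomial coefficients as sums over pairs\<close>

lemma image_mset_eq_mset_ex_list:
  "image_mset h M = mset xs \<Longrightarrow> \<exists>ys. mset ys = M \<and> map h ys = xs"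
proof (induction xs arbitrary: M)
  case Nil
  then show ?case by simp
next
  case (Cons x xs)
  then obtain N y where "M = add_mset y N" "h y = x" "image_mset h N = mset xs"
    by (metis msed_map_invR mset.simps(2))
  with Cons.IH[of N] obtain ys where "mset (y # ys) = M" "map h (y # ys) = x # xs"
    by auto
  then show ?case by (intro exI conjI)
qed

text \<open>Both sides count two-element sets of indices satisfying \<open>R\<close>. If
  \<open>R n\<close> holds, the new index \<open>n\<close> forms one pair with each earlier such
  index, which is Pascal's rule.\<close>

lemma choose_two_eq_sum:
  "card {i. i < (n::nat) \<and> R i} choose 2 = (\<Sum>j<n. \<Sum>i<j. of_bool (R i \<and> R j))"
proof (induction n)
  case (Suc n)
  have *: "{i. i < Suc n \<and> R i} = (if R n then insert n {i. i < n \<and> R i} else {i. i < n \<and> R i})"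
    by (auto simp: less_Suc_eq)
  have "(\<Sum>i<n. of_bool (R i)) = card {i. i < n \<and> R i}"
    by (simp add: of_bool_def sum.If_cases Int_def)
  then show ?case
    using Suc by (simp add: * numeral_2_eq_2)
qed simp

section \<open>Summation over all pairs of blocks\<close>

theorem mainTheorem7:
  fixes E :: "'e set" and s :: "nat list" and m1 m2 :: nat and P :: "'e set set"
  assumes "finite E"
    and "\<forall>i<length s. s ! i > 0"
    and "(\<Sum>i<length s. s ! i) = card E"
    and "m1 = card {i. i < length s \<and> s ! i = 1}"
    and "m2 = card {i. i < length s \<and> s ! i = 2}"
    and "P \<in> vertices (transposition_graph (mset s) E)"
  shows "int (degree (transposition_graph (mset s) E) P) =
    (\<Sum>j<length s. \<Sum>i<j. int (s ! i) * int (s ! j)) - int (m1 choose 2) - 2 * int (m2 choose 2)"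
proof -
  let ?n = "length s"
  have P: "P \<in> edge_partitions (mset s) E"
    using assms(6) by (simp add: transposition_graph_def)
  then have part: "partition_on E P" and "image_mset card (mset_set P) = mset s"
    by (auto simp: edge_partitions_def profile_def)
  \<comment> \<open>The blocks are listed in the order of the prescribed sizes, so that an index of
    \<open>s\<close> also names a block.\<close>
  then obtain g where g: "mset g = mset_set P" "map card g = s"
    using image_mset_eq_mset_ex_list by metis
  have "finite P"
    using finite_elements[OF \<open>finite E\<close> part] .
  then have set_g: "set g = P"
    using g(1) by (metis finite_set_mset_mset_set set_mset_mset)
  have dist: "distinct g"
    unfolding distinct_count_atmost_1 g(1) using \<open>finite P\<close> set_g by (simp add: count_mset_set')
  have len: "length g = ?n" and card_g: "\<And>i. i < ?n \<Longrightarrow> card (g ! i) = s ! i"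
    using g(2) by auto
  have in_P: "g ! i \<in> P" if "i < ?n" for i
    using that set_g len nth_mem by metis
  have g_neq: "g ! i \<noteq> g ! j" if "i < j" "j < ?n" for i j
    using that dist len by (simp add: nth_eq_iff_index_eq)
  \<comment> \<open>Each unordered pair of blocks occurs once, with \<open>i < j\<close>; the index
    \<open>j\<close> comes first because it bounds \<open>i\<close>.\<close>
  let ?I = "SIGMA j:{..<?n}. {..<j}"
  let ?N = "\<lambda>(j, i). swap_neighbours P (g ! i) (g ! j)"
  have nbhd: "{Q. Q \<noteq> P \<and> transposition_move P Q} = (\<Union>p\<in>?I. ?N p)"
  proof (intro equalityI subsetI)
    fix Q assume "Q \<in> {Q. Q \<noteq> P \<and> transposition_move P Q}"
    then obtain A B where AB: "A \<in> P" "B \<in> P" "A \<noteq> B" "Q \<in> swap_neighbours P A B"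
      unfolding mem_Collect_eq nontrivial_transposition_move_iff by blast
    then obtain i j where ij: "i < ?n" "j < ?n" "A = g ! i" "B = g ! j"
      using set_g len by (metis in_set_conv_nth)
    with AB have "i < j \<or> j < i"
      by (metis linorder_neqE_nat)
    \<comment> \<open>If \<open>j < i\<close>, symmetry in the two blocks lets the indices be
      exchanged.\<close>
    then show "Q \<in> (\<Union>p\<in>?I. ?N p)"
      using AB(4) ij swap_neighbours_commute by fastforce
  next
    fix Q assume "Q \<in> (\<Union>p\<in>?I. ?N p)"
    then obtain i j where "i < j" "j < ?n" "Q \<in> swap_neighbours P (g ! i) (g ! j)"
      by auto
    moreover from this have "g ! i \<in> P" "g ! j \<in> P" "g ! i \<noteq> g ! j"
      using in_P g_neq by simp_all
    ultimately show "Q \<in> {Q. Q \<noteq> P \<and> transposition_move P Q}"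
      unfolding mem_Collect_eq nontrivial_transposition_move_iff by metis
  qed
  have fin: "finite (?N p)" if "p \<in> ?I" for p
  proof -
    have "finite A" if "A \<in> P" for A
      using that partition_onD1[OF part] by (auto intro: finite_subset[OF _ \<open>finite E\<close>])
    with that show ?thesis
      using in_P by (auto simp: swap_neighbours_def)
  qed
  have disj: "?N p \<inter> ?N q = {}" if "p \<in> ?I" "q \<in> ?I" "p \<noteq> q" for p q
  proof (rule ccontr)
    assume "?N p \<inter> ?N q \<noteq> {}"
    moreover obtain j i l k where ij: "p = (j, i)" "q = (l, k)" "i < j" "j < ?n" "k < l" "l < ?n"
      using \<open>p \<in> ?I\<close> \<open>q \<in> ?I\<close> by auto
    ultimately obtain Q where "Q \<in> swap_neighbours P (g ! i) (g ! j)"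
      "Q \<in> swap_neighbours P (g ! k) (g ! l)"
      by auto
    moreover have "i < ?n" "k < ?n"
      using ij by simp_all
    \<comment> \<open>A common neighbour \<open>Q\<close> determines its pair of blocks;
      distinctness of \<open>g\<close> and the ordering of the indices then give
      \<open>p = q\<close>.\<close>
    ultimately have "P - Q = {g ! i, g ! j}" "P - Q = {g ! k, g ! l}"
      using ij swap_neighbours_diff[OF part in_P in_P g_neq] by blast+
    then have "{g ! i, g ! j} = {g ! k, g ! l}"
      by simp
    then show False
      using ij dist len \<open>p \<noteq> q\<close> by (auto simp: doubleton_eq_iff nth_eq_iff_index_eq)
  qed
  have "degree (transposition_graph (mset s) E) P = (\<Sum>p\<in>?I. card (?N p))"
    unfolding degree_transposition_graph[OF \<open>finite E\<close> P] nbhd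
    using fin disj by (intro card_UN_disjoint) auto
  also have "\<dots> = (\<Sum>j<?n. \<Sum>i<j. card (swap_neighbours P (g ! i) (g ! j)))"
    by (subst sum.Sigma) (auto intro: sum.cong)
  \<comment> \<open>Over the integers the correction terms can be moved across by genuine
    subtraction.\<close>
  finally have "int (degree (transposition_graph (mset s) E) P)
      = (\<Sum>j<?n. \<Sum>i<j. int (card (swap_neighbours P (g ! i) (g ! j))))"
    by simp
  also have "\<dots> = (\<Sum>j<?n. \<Sum>i<j. int (s ! i) * int (s ! j)
      - int (of_bool (s ! i = 1 \<and> s ! j = 1)) - 2 * int (of_bool (s ! i = 2 \<and> s ! j = 2)))"
  proof (intro sum.cong refl)
    fix j i assume "j \<in> {..<?n}" "i \<in> {..<j}"
    then have "i < j" "i < ?n" "j < ?n" by auto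
    then have "int (s ! i * s ! j) = int (card (swap_neighbours P (g ! i) (g ! j))
        + of_bool (s ! i = 1 \<and> s ! j = 1) + 2 * of_bool (s ! i = 2 \<and> s ! j = 2))"
      using card_swap_neighbours[OF part in_P in_P g_neq, of i j] card_g by metis
    then show "int (card (swap_neighbours P (g ! i) (g ! j))) = int (s ! i) * int (s ! j)
      - int (of_bool (s ! i = 1 \<and> s ! j = 1)) - 2 * int (of_bool (s ! i = 2 \<and> s ! j = 2))"
      unfolding of_nat_add of_nat_mult by linarith
  qed
  \<comment> \<open>The indicator sums count pairs of blocks of size 1 and pairs of blocks of size
    2, which gives the two binomial coefficients.\<close>
  also have "\<dots> = (\<Sum>j<?n. \<Sum>i<j. int (s ! i) * int (s ! j)) - int (m1 choose 2) - 2 * int (m2 choose 2)"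
    unfolding assms(4,5) choose_two_eq_sum of_nat_sum sum_subtractf sum_distrib_left ..
  finally show ?thesis .
qed

end
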